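(* Let $u:[0,\infty)\to[0,\infty)$ be concave and non-decreasing, continuous on $[0,\infty)$ and differentiable on $(0,\infty)$, with $\lim_{d\to\infty} u'(d)=0$. Let $j$ range over a finite nonempty index set of generators. For each $j$ let $C_j:[0,\infty)\to[0,\infty)$ be lower semicontinuous, and let $S_j\ge 0$ and $0\le m_j\le M_j$ with $M_j>0$ be real numbers. Let $X$, $v$, $v^h$ and $\varphi$ be the feasible set, cost function, convex hull of the cost function and dual function defined in the context. Consider the dual problem $$\min_{\lambda\in\mathbb{R}}\ \varphi(\lambda),\qquad \varphi(\lambda)=\max_{d\ge 0}\{u(d)-\lambda d\}+\max_{(g,z)\in X}\Big\{\lambda\sum_j g_j-\Big(\sum_j C_j(g_j)+\sum_j S_jz_j\Big)\Big\}.$$ Then there exists a tuple $(\lambda^*,g^*,z^*,d^* )$ such that the following statements hold: 1. $(\lambda^*,g^*,z^*,d^* )$ is an optimal solution of the dual problem; that is, $\lambda^*\in\mathbb{R}$ minimizes $\varphi$ over $\mathbb{R}$, $d^*\ge 0$ attains $\max_{d\ge 0}\{u(d)-\lambda^* d\}$, and $(g^*,z^* )\in X$ attains $\max_{(g,z)\in X}\{\lambda^*\sum_j g_j-(\sum_j C_j(g_j)+\sum_j S_jz_j)\}$. 2. The dual problem is equivalent to the problem $\max_{d\ge 0}\ u(d)-v^h(d)$, in the sense that $$\min_{\lambda\in\mathbb{R}}\varphi(\lambda)=\max_{d\ge 0}\{u(d)-v^h(d)\}.$$ 3. $\lambda^*$ is a convex hull price at the demand $d^*$, i.e., $\lambda^*\in\partial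 v^h(d^* )$.
   Context: The function $u$ is the utility function of a consumer. Each generator $j$ has variable cost function $C_j$, startup cost $S_j$, minimum output $m_j$ and maximum output $M_j$; $g_j\in\mathbb{R}$ is its output and $z_j\in\{0,1\}$ its commitment decision, with vectors $g=(g_j)_j$ and $z=(z_j)_j$. Feasible set: $X:=\{(g,z)\mid m_jz_j\le g_j\le M_jz_j,\ z_j\in\{0,1\}\ \text{for all } j\}$. Cost function (optimal value of the unit commitment problem): $v:[0,\infty)\to[0,\infty]$, $$v(y):=\inf\Big\{\sum_j C_j(g_j)+\sum_j S_jz_j\ \Big|\ (g,z)\in X,\ \sum_j g_j=y\Big\},$$ with $v(y)=+\infty$ if no $(g,z)\in X$ satisfies $\sum_j g_j=y$. Convex hull of $v$: $v^h(y):=\inf\{\mu\mid (y,\mu)\in\operatorname{conv}(\operatorname{epi}(v))\}$ for $y\ge 0$, where $\operatorname{epi}(v)=\{(y,\mu)\in[0,\infty)\times\mathbb{R}\mid \mu\ge v(y)\}$, $\operatorname{conv}$ denotes the convex hull of a set, and $\inf\emptyset=+\infty$. Subdifferential: for $y\ge 0$ with $v^h(y)<\infty$, $\partial v^h(y)=\{p\in\mathbb{R}\mid v^h(x)\ge v^h(y)+p(x-y)\ \text{for all } x\ge 0\}$. A convex hull price at a demand $y$ is an element $p^h\in\partial v^h(y)$. In the definition of $\varphi$, a "max" is understood as a supremum with values in $(-\infty,+\infty]$ (so, e.g., it is $+\infty$ when unbounded above). The function $\varphi$ is the partial Lagrangian dual function, obtained by dualizing the constraint $\sum_j g_j=d$,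 of the social welfare maximization problem of maximizing $u(d)-\{\sum_j C_j(g_j)+\sum_j S_jz_j\}$ subject to $\sum_j g_j=d$, $d\ge 0$, $(g,z)\in X$. *)

theory Defs
  imports "HOL-Analysis.Analysis"
begin

definition lower_semicontinuous_on :: "'a::topological_space set \<Rightarrow> ('a \<Rightarrow> real) \<Rightarrow> bool" where
  "lower_semicontinuous_on A f \<longleftrightarrow>
     (\<forall>x\<in>A. ereal (f x) \<le> Liminf (at x within A) (\<lambda>y. ereal (f y)))"

definition feasible_set ::
    "('j \<Rightarrow> real) \<Rightarrow> ('j \<Rightarrow> real) \<Rightarrow> (('j \<Rightarrow> real) \<times> ('j \<Rightarrow> real)) set" where
  "feasible_set m M = {(g, z). \<forall>j. m j * z j \<le> g j \<and> g j \<le> M j * z j \<and> z j \<in> {0, 1}}"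

definition total_cost ::
    "('j::finite \<Rightarrow> real \<Rightarrow> real) \<Rightarrow> ('j \<Rightarrow> real) \<Rightarrow> ('j \<Rightarrow> real) \<Rightarrow> ('j \<Rightarrow> real) \<Rightarrow> real" where
  "total_cost C S g z = (\<Sum>j\<in>UNIV. C j (g j)) + (\<Sum>j\<in>UNIV. S j * z j)"

definition cost_fun ::
    "('j::finite \<Rightarrow> real \<Rightarrow> real) \<Rightarrow> ('j \<Rightarrow> real) \<Rightarrow> ('j \<Rightarrow> real) \<Rightarrow> ('j \<Rightarrow> real) \<Rightarrow> real \<Rightarrow> ereal" where
  "cost_fun C S m M y =
     Inf {ereal (total_cost C S g z) |g z. (g, z) \<in> feasible_set m M \<and> (\<Sum>j\<in>UNIV. g j) = y}"

text \<open>Functions on the half-line \<open>[0,\<infinity>)\<close> are represented by total functions on the reals whose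
  values at negative arguments are ignored. The library's \<^const>\<open>epigraph\<close> does not apply here,
  since it is restricted to real-valued functions.\<close>

definition epi_nonneg :: "(real \<Rightarrow> ereal) \<Rightarrow> (real \<times> real) set" where
  "epi_nonneg f = {(y, \<mu>). 0 \<le> y \<and> f y \<le> ereal \<mu>}"

definition convex_hull_fun :: "(real \<Rightarrow> ereal) \<Rightarrow> real \<Rightarrow> ereal" where
  "convex_hull_fun f y = Inf {ereal \<mu> |\<mu>. (y, \<mu>) \<in> convex hull (epi_nonneg f)}"

definition subdifferential_nonneg :: "(real \<Rightarrow> ereal) \<Rightarrow> real \<Rightarrow> real set" where
  "subdifferential_nonneg f y =
     {p. 0 \<le> y \<and> f y < \<infinity> \<and> (\<forall>x\<ge>0. f x \<ge> f y + ereal (p * (x - y)))}"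

definition generator_profit ::
    "('j::finite \<Rightarrow> real \<Rightarrow> real) \<Rightarrow> ('j \<Rightarrow> real) \<Rightarrow> real \<Rightarrow> ('j \<Rightarrow> real) \<times> ('j \<Rightarrow> real) \<Rightarrow> real" where
  "generator_profit C S l = (\<lambda>(g, z). l * (\<Sum>j\<in>UNIV. g j) - total_cost C S g z)"

definition dual_fun ::
    "(real \<Rightarrow> real) \<Rightarrow> ('j::finite \<Rightarrow> real \<Rightarrow> real) \<Rightarrow> ('j \<Rightarrow> real) \<Rightarrow> ('j \<Rightarrow> real) \<Rightarrow> ('j \<Rightarrow> real)
      \<Rightarrow> real \<Rightarrow> ereal" where
  "dual_fun u C S m M l =
     (SUP d\<in>{0..}. ereal (u d - l * d)) +
     (SUP x\<in>feasible_set m M. ereal (generator_profit C S l x))"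

end

theory Submission
  imports Defs
begin

text \<open>
  Restricting the demand to \<open>[0, D + 1]\<close>, where \<open>D = (\<Sum>j. M j)\<close>, turns the dual function into a
  maximum of the affine functions \<open>\<lambda> \<mapsto> \<lambda> * a q - c q\<close> over a compact set of points
  \<open>q = ((g, z), d)\<close>, with \<open>a q = (\<Sum>j. g j) - d\<close> the excess supply and \<open>c\<close> lower semicontinuous.
  Since \<open>a\<close> takes both signs, a minimizer \<open>\<lambda>\<close> exists, and among the maximizers \<open>q\<close> at \<open>\<lambda>\<close> there are
  one with \<open>a q \<le> 0\<close> and one with \<open>a q \<ge> 0\<close>. Mixing the two so that the excess supply vanishes yields
  a demand \<open>d\<close> that is optimal at price \<open>\<lambda>\<close>, by concavity even without the bound \<open>D + 1\<close>, and that is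
  at the same time a convex combination of optimal supplies. Hence the supporting line of slope
  \<open>\<lambda>\<close> of the convex hull of the cost function touches it at \<open>d\<close>, and all three claims follow.
\<close>

section \<open>Lower semicontinuity\<close>

text \<open>Passes from the punctured filter to \<open>nhds x\<close>, which costs nothing because
  \<open>k < f x\<close> covers \<open>x\<close> itself, and from extended to real bounds. Later
  proofs use only this form.\<close>

lemma lower_semicontinuous_on_iff:
  "lower_semicontinuous_on A f \<longleftrightarrow>
     (\<forall>x\<in>A. \<forall>k<f x. \<forall>\<^sub>F y in nhds x. y \<in> A \<longrightarrow> k < f y)"
proof -
  have "ereal (f x) \<le> Liminf (at x within A) (\<lambda>y. ereal (f y)) \<longleftrightarrow>
      (\<forall>k<f x. \<forall>\<^sub>F y in nhds x. y \<in> A \<longrightarrow> k < f y)" (is "?L \<longleftrightarrow> ?R") for x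
  proof
    assume L: ?L
    show ?R
    proof (intro allI impI)
      fix k assume k: "k < f x"
      with L have "\<forall>\<^sub>F y in at x within A. k < f y"
        unfolding le_Liminf_iff by (auto dest: spec[where x = "ereal k"])
      then show "\<forall>\<^sub>F y in nhds x. y \<in> A \<longrightarrow> k < f y"
        unfolding eventually_at_filter by eventually_elim (use k in auto)
    qed
  next
    assume R: ?R
    have "\<forall>\<^sub>F y in at x within A. k < ereal (f y)" if k: "k < ereal (f x)" for k
    proof (cases k)
      case (real r)
      with k R have "\<forall>\<^sub>F y in nhds x. y \<in> A \<longrightarrow> r < f y" by auto
      then show ?thesis
        unfolding eventually_at_filter by eventually_elim (use real in auto)
    qed (use k in auto)
    then show ?L unfolding le_Liminf_iff by blast
  qed
  then show ?thesis by (simp add: lower_semicontinuous_on_def)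
qed

lemma continuous_imp_lower_semicontinuous_on:
  assumes "continuous_on A f"
  shows "lower_semicontinuous_on A f"
  unfolding lower_semicontinuous_on_iff
proof (intro ballI allI impI)
  fix x k assume x: "x \<in> A" and k: "k < f x"
  have "(f \<longlongrightarrow> f x) (at x within A)"
    using assms x by (simp add: continuous_on_def)
  then have "\<forall>\<^sub>F y in at x within A. k < f y"
    using k by (rule order_tendstoD)
  then show "\<forall>\<^sub>F y in nhds x. y \<in> A \<longrightarrow> k < f y"
    unfolding eventually_at_filter by eventually_elim (use k in auto)
qed

lemma lower_semicontinuous_on_add:
  assumes "lower_semicontinuous_on A f" "lower_semicontinuous_on A g"
  shows "lower_semicontinuous_on A (\<lambda>x. f x + g x)"
  unfolding lower_semicontinuous_on_iff
proof (intro ballI allI impI)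
  fix x k assume x: "x \<in> A" and k: "k < f x + g x"
  define e where "e = (f x + g x - k) / 2"
  have e: "e > 0" "k = (f x - e) + (g x - e)" using k by (auto simp: e_def field_simps)
  have "\<forall>\<^sub>F y in nhds x. y \<in> A \<longrightarrow> f x - e < f y" "\<forall>\<^sub>F y in nhds x. y \<in> A \<longrightarrow> g x - e < g y"
    using assms x e by (auto simp: lower_semicontinuous_on_iff)
  then show "\<forall>\<^sub>F y in nhds x. y \<in> A \<longrightarrow> k < f y + g y"
    by eventually_elim (use e in auto)
qed

lemma lower_semicontinuous_on_sum:
  assumes "finite I" "\<And>i. i \<in> I \<Longrightarrow> lower_semicontinuous_on A (f i)"
  shows "lower_semicontinuous_on A (\<lambda>x. \<Sum>i\<in>I. f i x)"
  using assms
proof (induction I rule: finite_induct)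
  case empty
  then show ?case by (simp add: continuous_imp_lower_semicontinuous_on)
next
  case (insert i I)
  then show ?case by (simp add: lower_semicontinuous_on_add)
qed

lemma lower_semicontinuous_on_compose:
  assumes f: "lower_semicontinuous_on B f" and h: "continuous_on A h" and hA: "h ` A \<subseteq> B"
  shows "lower_semicontinuous_on A (\<lambda>x. f (h x))"
  unfolding lower_semicontinuous_on_iff
proof (intro ballI allI impI)
  fix x k assume x: "x \<in> A" and k: "k < f (h x)"
  have "\<forall>\<^sub>F y in nhds (h x). y \<in> B \<longrightarrow> k < f y"
    using f x hA k by (auto simp: lower_semicontinuous_on_iff)
  moreover have "filterlim h (nhds (h x)) (at x within A)"
    using h x by (simp add: continuous_on_def)
  ultimately have "\<forall>\<^sub>F y in at x within A. h y \<in> B \<longrightarrow> k < f (h y)"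
    by (rule eventually_compose_filterlim)
  then show "\<forall>\<^sub>F y in nhds x. y \<in> A \<longrightarrow> k < f (h y)"
    unfolding eventually_at_filter by eventually_elim (use hA k in auto)
qed

text \<open>Without a minimum each \<open>x\<close> has a point \<open>w x\<close> of smaller value,
  and \<open>f\<close> stays above \<open>f (w x)\<close> near \<open>x\<close>. Take the least
  \<open>f (w x)\<close> over the centres of a finite subcover: the member containing that
  \<open>w x\<close> contradicts minimality.\<close>

lemma lower_semicontinuous_attains_inf:
  fixes f :: "'a::topological_space \<Rightarrow> real"
  assumes "compact Q" "Q \<noteq> {}" and f: "lower_semicontinuous_on Q f"
  shows "\<exists>x\<in>Q. \<forall>y\<in>Q. f x \<le> f y"
proof (rule ccontr)
  assume "\<not> ?thesis"
  then have "\<forall>x\<in>Q. \<exists>y\<in>Q. f y < f x" by (meson not_le)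
  then obtain w where w: "\<And>x. x \<in> Q \<Longrightarrow> w x \<in> Q" "\<And>x. x \<in> Q \<Longrightarrow> f (w x) < f x"
    by metis
  have "\<forall>x\<in>Q. \<exists>U. open U \<and> x \<in> U \<and> (\<forall>y\<in>U. y \<in> Q \<longrightarrow> f (w x) < f y)"
    using f w(2) unfolding lower_semicontinuous_on_iff eventually_nhds by metis
  then obtain U where U: "\<And>x. x \<in> Q \<Longrightarrow> open (U x)" "\<And>x. x \<in> Q \<Longrightarrow> x \<in> U x"
      "\<And>x y. x \<in> Q \<Longrightarrow> y \<in> U x \<Longrightarrow> y \<in> Q \<Longrightarrow> f (w x) < f y"
    by metis
  have "Q \<subseteq> (\<Union>x\<in>Q. U x)" using U(2) by blast
  then obtain T where T: "T \<subseteq> Q" "finite T" "Q \<subseteq> (\<Union>x\<in>T. U x)"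
    using compactE_image[OF \<open>compact Q\<close>, of Q U] U(1) by metis
  have "T \<noteq> {}" using T(3) \<open>Q \<noteq> {}\<close> by auto
  then obtain x where x: "x \<in> T" "\<And>y. y \<in> T \<Longrightarrow> f (w x) \<le> f (w y)"
    using ex_min_if_finite[of "(\<lambda>x. f (w x)) ` T"] T(2) by (auto simp: not_less)
  have "w x \<in> Q" using x T w by blast
  then obtain y where "y \<in> T" "w x \<in> U y" using T(3) by blast
  then have "f (w y) < f (w x)" using U(3) T(1) \<open>w x \<in> Q\<close> by blast
  with x(2)[OF \<open>y \<in> T\<close>] show False by simp
qed

section \<open>Minimizing a maximum of affine functions\<close>

lemma mult_le_abs_mult:
  fixes l x A :: real
  assumes "\<bar>x\<bar> \<le> A"
  shows "l * x \<le> \<bar>l\<bar> * A"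
proof -
  have "l * x \<le> \<bar>l\<bar> * \<bar>x\<bar>" by (metis abs_ge_self abs_mult)
  also have "\<dots> \<le> \<bar>l\<bar> * A" using assms by (rule mult_left_mono) simp
  finally show ?thesis .
qed

text \<open>The supremum is Lipschitz with constant \<open>A\<close>, hence continuous. The lines of
  \<open>p\<close> and \<open>r\<close>, of opposite slopes, force it to be at least its value at 0
  outside a compact interval, so a minimum on that interval is global.\<close>

lemma minimizer_of_sup_affine:
  fixes a c :: "'q \<Rightarrow> real"
  assumes a_bound: "\<And>q. q \<in> Q \<Longrightarrow> \<bar>a q\<bar> \<le> A" and c_bound: "\<And>q. q \<in> Q \<Longrightarrow> B \<le> c q"
    and p: "p \<in> Q" "0 < a p" and r: "r \<in> Q" "a r < 0"
  shows "\<exists>l. \<forall>\<mu>. (SUP q\<in>Q. l * a q - c q) \<le> (SUP q\<in>Q. \<mu> * a q - c q)"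
proof -
  define \<psi> where "\<psi> l = (SUP q\<in>Q. l * a q - c q)" for l
  have Q: "Q \<noteq> {}" using p by auto
  have l_a: "l * a q \<le> \<bar>l\<bar> * A" if "q \<in> Q" for l q
    by (rule mult_le_abs_mult[OF a_bound[OF that]])
  have "bdd_above ((\<lambda>q. l * a q - c q) ` Q)" for l
    by (rule bdd_aboveI2[where M = "\<bar>l\<bar> * A - B"]) (use l_a c_bound in \<open>fastforce intro: diff_mono\<close>)
  then have upper: "l * a q - c q \<le> \<psi> l" if "q \<in> Q" for l q
    unfolding \<psi>_def using that by (intro cSUP_upper)
  have lip: "\<psi> l \<le> \<psi> \<mu> + \<bar>l - \<mu>\<bar> * A" for l \<mu>
    unfolding \<psi>_def[of l]
  proof (rule cSUP_least[OF Q])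
    fix q assume q: "q \<in> Q"
    have "l * a q - c q = (\<mu> * a q - c q) + (l - \<mu>) * a q" by (simp add: algebra_simps)
    then show "l * a q - c q \<le> \<psi> \<mu> + \<bar>l - \<mu>\<bar> * A"
      using upper[OF q, of \<mu>] l_a[OF q, of "l - \<mu>"] by linarith
  qed
  have A: "A \<ge> 0" using a_bound[OF p(1)] by simp
  have cont: "continuous_on S \<psi>" for S
  proof -
    have "A-lipschitz_on S \<psi>"
    proof (rule lipschitz_onI[OF _ A])
      fix x y
      show "dist (\<psi> x) (\<psi> y) \<le> A * dist x y"
        using lip[of x y] lip[of y x] by (auto simp: dist_real_def abs_le_iff abs_minus_commute mult.commute)
    qed
    then show ?thesis by (rule lipschitz_on_continuous_on)
  qed
  \<comment> \<open>\<open>R1\<close> and \<open>R2\<close> are the prices at which the lines of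
    \<open>p\<close> and \<open>r\<close> reach the height \<open>\<psi> 0\<close>. At price 0 both
    lines are below it, so 0 lies in between.\<close>
  define R1 where "R1 = (\<psi> 0 + c p) / a p"
  define R2 where "R2 = (\<psi> 0 + c r) / a r"
  have R1: "R1 \<ge> 0" using upper[OF p(1), of 0] p(2) by (simp add: R1_def)
  have R2: "R2 \<le> 0" using upper[OF r(1), of 0] r(2) by (simp add: R2_def divide_nonneg_neg)
  obtain l where l: "l \<in> {R2..R1}" "\<And>\<mu>. \<mu> \<in> {R2..R1} \<Longrightarrow> \<psi> l \<le> \<psi> \<mu>"
    using continuous_attains_inf[OF compact_Icc _ cont, of R2 R1] R1 R2 by auto
  have "\<psi> l \<le> \<psi> \<mu>" for \<mu>
  proof -
    have l0: "\<psi> l \<le> \<psi> 0" using l(2) R1 R2 by simp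
    consider "\<mu> \<in> {R2..R1}" | "\<mu> > R1" | "\<mu> < R2" by fastforce
    then show ?thesis
    proof cases
      case 1
      then show ?thesis by (rule l(2))
    next
      case 2
      then have "\<psi> 0 \<le> \<mu> * a p - c p" using p(2) by (simp add: R1_def field_simps)
      then show ?thesis using upper[OF p(1), of \<mu>] l0 by linarith
    next
      case 3
      then have "\<psi> 0 \<le> \<mu> * a r - c r" using r(2) by (simp add: R2_def field_simps)
      then show ?thesis using upper[OF r(1), of \<mu>] l0 by linarith
    qed
  qed
  then show ?thesis unfolding \<psi>_def by blast
qed

text \<open>Since \<open>l\<close> is a minimizer, a small rise of the price does not lower the
  supremum, which yields near-maximizers at \<open>l\<close> of almost nonnegative slope. Minimizing
  a lower semicontinuous penalty over the compact \<open>Q\<close> replaces a limit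
  argument.\<close>

lemma maximizer_of_nonneg_slope:
  fixes a c :: "'q::topological_space \<Rightarrow> real"
  assumes Q: "compact Q" and a: "continuous_on Q a" and c: "lower_semicontinuous_on Q c"
    and bdd: "\<And>l. bdd_above ((\<lambda>q. l * a q - c q) ` Q)" and Q_ne: "Q \<noteq> {}"
    and min: "\<And>\<mu>. (SUP q\<in>Q. l * a q - c q) \<le> (SUP q\<in>Q. \<mu> * a q - c q)"
  shows "\<exists>r\<in>Q. 0 \<le> a r \<and> (\<forall>q\<in>Q. l * a q - c q \<le> l * a r - c r)"
proof -
  define \<psi> where "\<psi> l = (SUP q\<in>Q. l * a q - c q)" for l
  have upper: "l * a q - c q \<le> \<psi> l" if "q \<in> Q" for l q
    unfolding \<psi>_def using that bdd by (intro cSUP_upper)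
  obtain A where A: "A > 0" "\<And>q. q \<in> Q \<Longrightarrow> \<bar>a q\<bar> \<le> A"
    using compact_imp_bounded[OF compact_continuous_image[OF a Q]]
    by (auto simp: bounded_pos)
  define P where "P = {q \<in> Q. 0 \<le> a q}"
  \<comment> \<open>A near-maximizer at the larger price \<open>l + e\<close> cannot have a much negative slope, as the minimum is
      at \<open>l\<close>; with precision \<open>e\<^sup>2\<close> the slope is at least \<open>- e\<close>.\<close>
  have near: "\<exists>q\<in>Q. - e \<le> a q \<and> \<psi> l - e * A - e * e \<le> l * a q - c q" if e: "e > 0" for e
  proof -
    have "\<psi> (l + e) - e * e < \<psi> (l + e)" using e by simp
    then obtain q where q: "q \<in> Q" "\<psi> (l + e) - e * e < (l + e) * a q - c q"
      unfolding \<psi>_def using less_cSUP_iff[OF Q_ne bdd] by blast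
    have m: "\<psi> l \<le> \<psi> (l + e)" unfolding \<psi>_def by (rule min)
    have "0 \<le> e * (a q + e)"
      using q m upper[OF q(1), of l] by (simp add: algebra_simps)
    then have "- e \<le> a q" using e by (simp add: zero_le_mult_iff)
    moreover have "e * a q \<le> e * A" using A(2)[OF q(1)] e by simp
    then have "\<psi> l - e * A - e * e \<le> l * a q - c q"
      using q(2) m by (simp add: algebra_simps)
    ultimately show ?thesis using q(1) by blast
  qed
  \<comment> \<open>The penalty vanishes exactly at maximizers of nonnegative slope.\<close>
  define f where "f q = max (- a q) (\<psi> l - l * a q + c q)" for q
  have "lower_semicontinuous_on Q f"
  proof -
    have "lower_semicontinuous_on Q (\<lambda>q. - a q)"
      by (intro continuous_imp_lower_semicontinuous_on continuous_intros a)
    moreover have "lower_semicontinuous_on Q (\<lambda>q. \<psi> l - l * a q + c q)"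
      by (intro lower_semicontinuous_on_add c continuous_imp_lower_semicontinuous_on
          continuous_intros a)
    ultimately show ?thesis
      unfolding lower_semicontinuous_on_iff f_def less_max_iff_disj
      by (blast intro: eventually_mono)
  qed
  then obtain r where r: "r \<in> Q" "\<And>q. q \<in> Q \<Longrightarrow> f r \<le> f q"
    using lower_semicontinuous_attains_inf[OF Q Q_ne] by blast
  have "f r \<le> 0"
  proof (rule ccontr)
    assume "\<not> f r \<le> 0"
    \<comment> \<open>With \<open>e \<le> 1\<close> the penalty of the near-maximizer is at most
      \<open>e * (A + 1)\<close>, strictly less than \<open>e * (A + 2)\<close>, which is at most
      the minimum \<open>f r\<close>.\<close>
    define e where "e = min 1 (f r / (A + 2))"
    have e: "e > 0" "e \<le> 1"
      using \<open>\<not> f r \<le> 0\<close> A(1) by (auto simp: e_def)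
    have "e \<le> f r / (A + 2)" by (simp add: e_def)
    then have e_le: "e * (A + 2) \<le> f r"
      using A(1) by (simp add: pos_le_divide_eq)
    obtain q where q: "q \<in> Q" "- e \<le> a q" "\<psi> l - e * A - e * e \<le> l * a q - c q"
      using near[OF e(1)] by blast
    have "e * e \<le> e" using e by (simp add: mult_left_le)
    moreover have "0 < e * A" using e A(1) by simp
    moreover have "e * (A + 2) = e * A + 2 * e" by (simp add: algebra_simps)
    ultimately have "f q < e * (A + 2)"
      using q e(1) unfolding f_def by (simp; linarith)
    then show False using r(2)[OF q(1)] e_le by linarith
  qed
  then have "0 \<le> a r" "\<psi> l \<le> l * a r - c r" by (auto simp: f_def)
  then show ?thesis using r(1) upper order_trans by blast
qed

lemma minimax_affine:
  fixes a c :: "'q::topological_space \<Rightarrow> real"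
  assumes Q: "compact Q" and a: "continuous_on Q a" and c: "lower_semicontinuous_on Q c"
    and p: "p \<in> Q" "0 < a p" and r: "r \<in> Q" "a r < 0"
  obtains l q q' where "q \<in> Q" "q' \<in> Q" "a q \<le> 0" "0 \<le> a q'"
    "\<And>x. x \<in> Q \<Longrightarrow> l * a x - c x \<le> l * a q - c q"
    "\<And>x. x \<in> Q \<Longrightarrow> l * a x - c x \<le> l * a q' - c q'"
proof -
  have Q_ne: "Q \<noteq> {}" using p by auto
  obtain A where A: "\<And>q. q \<in> Q \<Longrightarrow> \<bar>a q\<bar> \<le> A"
    using compact_imp_bounded[OF compact_continuous_image[OF a Q]]
    by (auto simp: bounded_iff)
  obtain B where B: "\<And>q. q \<in> Q \<Longrightarrow> B \<le> c q"
    using lower_semicontinuous_attains_inf[OF Q Q_ne c] by blast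
  have bdd: "bdd_above ((\<lambda>q. l * a q - c q) ` Q)" for l
  proof (rule bdd_aboveI2[where M = "\<bar>l\<bar> * A - B"])
    fix q assume q: "q \<in> Q"
    have "l * a q \<le> \<bar>l\<bar> * A"
      by (rule mult_le_abs_mult[OF A[OF q]])
    then show "l * a q - c q \<le> \<bar>l\<bar> * A - B" using B[OF q] by linarith
  qed
  obtain l where l: "\<And>\<mu>. (SUP q\<in>Q. l * a q - c q) \<le> (SUP q\<in>Q. \<mu> * a q - c q)"
    using minimizer_of_sup_affine[of Q a A B c, OF A B p r] by blast
  obtain q' where q': "q' \<in> Q" "0 \<le> a q'" "\<And>x. x \<in> Q \<Longrightarrow> l * a x - c x \<le> l * a q' - c q'"
    using maximizer_of_nonneg_slope[of Q a c l, OF Q a c bdd Q_ne l] by blast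
  \<comment> \<open>Negating both price and slope leaves every affine value unchanged, so the same
    lemma gives a maximizer of nonpositive slope.\<close>
  have "\<exists>q\<in>Q. 0 \<le> - a q \<and> (\<forall>x\<in>Q. (- l) * (- a x) - c x \<le> (- l) * (- a q) - c q)"
  proof (rule maximizer_of_nonneg_slope[of Q "\<lambda>q. - a q" c "- l", OF Q _ c _ Q_ne])
    show "continuous_on Q (\<lambda>q. - a q)" by (intro continuous_intros a)
    show "bdd_above ((\<lambda>q. \<mu> * - a q - c q) ` Q)" for \<mu>
      using bdd[of "- \<mu>"] by simp
    show "(SUP q\<in>Q. - l * - a q - c q) \<le> (SUP q\<in>Q. \<mu> * - a q - c q)" for \<mu>
      using l[of "- \<mu>"] by simp
  qed
  then obtain q where "q \<in> Q" "a q \<le> 0" "\<And>x. x \<in> Q \<Longrightarrow> l * a x - c x \<le> l * a q - c q"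
    by auto
  with q' show thesis using that by blast
qed

section \<open>The generators\<close>

text \<open>A closed subset of a product of intervals, which is compact by Tychonoff.\<close>

lemma compact_feasible_set:
  fixes m M :: "'j::finite \<Rightarrow> real"
  assumes m_nonneg: "\<And>j. 0 \<le> m j" and M_nonneg: "\<And>j. 0 \<le> M j"
  shows "compact (feasible_set m M)"
proof -
  define K where "K = PiE UNIV (\<lambda>j. {0..M j}) \<times> PiE UNIV (\<lambda>_::'j. {0..1::real})"
  have box: "compact (PiE UNIV B)" if "\<And>j. compact (B j)" for B :: "'j \<Rightarrow> real set"
  proof -
    have "compactin (product_topology (\<lambda>_. euclidean) UNIV) (PiE UNIV B)"
      unfolding compactin_PiE using that by simp
    then show ?thesis by (simp add: euclidean_product_topology)
  qed
  have "compact K" unfolding K_def by (intro compact_Times box compact_Icc)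
  have fst_cont: "continuous_on UNIV (\<lambda>x::('j \<Rightarrow> real) \<times> ('j \<Rightarrow> real). fst x j)" for j
    by (rule continuous_on_product_then_coordinatewise) (intro continuous_intros)
  have snd_cont: "continuous_on UNIV (\<lambda>x::('j \<Rightarrow> real) \<times> ('j \<Rightarrow> real). snd x j)" for j
    by (rule continuous_on_product_then_coordinatewise) (intro continuous_intros)
  have "feasible_set m M =
      {x. \<forall>j. m j * snd x j \<le> fst x j \<and> fst x j \<le> M j * snd x j \<and> (snd x j = 0 \<or> snd x j = 1)}"
    by (auto simp: feasible_set_def)
  moreover have "closed \<dots>"
    by (intro closed_Collect_all closed_Collect_conj closed_Collect_disj closed_Collect_le
        closed_Collect_eq continuous_intros fst_cont snd_cont)
  ultimately have "closed (feasible_set m M)" by simp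
  moreover have "feasible_set m M \<subseteq> K"
  proof
    fix x assume "x \<in> feasible_set m M"
    then obtain g z where x: "x = (g, z)"
      and gz: "\<And>j. m j * z j \<le> g j \<and> g j \<le> M j * z j \<and> z j \<in> {0, 1}"
      by (auto simp: feasible_set_def)
    have "0 \<le> g j \<and> g j \<le> M j \<and> 0 \<le> z j \<and> z j \<le> 1" for j
      using gz[of j] m_nonneg[of j] M_nonneg[of j] by auto
    then show "x \<in> K" by (auto simp: x K_def)
  qed
  ultimately show ?thesis
    using \<open>compact K\<close> by (metis compact_Int_closed inf.absorb_iff2)
qed

lemma feasible_output_bounds:
  assumes "(g, z) \<in> feasible_set m M" "\<And>j. 0 \<le> m j" "\<And>j. 0 \<le> M j"
  shows "0 \<le> g j" "g j \<le> M j"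
proof -
  have "m j * z j \<le> g j" "g j \<le> M j * z j" "z j = 0 \<or> z j = 1"
    using assms(1) by (auto simp: feasible_set_def)
  then show "0 \<le> g j" "g j \<le> M j"
    using assms(2,3)[of j] by auto
qed

lemma lower_semicontinuous_on_total_cost:
  fixes C :: "'j::finite \<Rightarrow> real \<Rightarrow> real"
  assumes "\<And>j. lower_semicontinuous_on {0..} (C j)" "\<And>j. 0 \<le> m j" "\<And>j. 0 \<le> M j"
  shows "lower_semicontinuous_on (feasible_set m M) (\<lambda>x. total_cost C S (fst x) (snd x))"
  unfolding total_cost_def
proof (intro lower_semicontinuous_on_add lower_semicontinuous_on_sum finite)
  fix j
  \<comment> \<open>\<open>C j\<close> is controlled on the half-line only, so the coordinate map
    has to send feasible points there.\<close>
  show "lower_semicontinuous_on (feasible_set m M) (\<lambda>x. C j (fst x j))"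
  proof (rule lower_semicontinuous_on_compose[OF assms(1)])
    show "continuous_on (feasible_set m M) (\<lambda>x. fst x j)"
      by (rule continuous_on_product_then_coordinatewise) (intro continuous_intros)
    show "(\<lambda>x. fst x j) ` feasible_set m M \<subseteq> {0..}"
      using feasible_output_bounds[OF _ assms(2,3)] by auto
  qed
  have "continuous_on (feasible_set m M) (\<lambda>x. snd x j)"
    by (rule continuous_on_product_then_coordinatewise) (intro continuous_intros)
  then show "lower_semicontinuous_on (feasible_set m M) (\<lambda>x. S j * snd x j)"
    by (intro continuous_imp_lower_semicontinuous_on continuous_intros)
qed

section \<open>The convex hull of the cost function\<close>

text \<open>The bound puts the epigraph into a half-plane, which is convex and so contains the hull
  too.\<close>

lemma convex_hull_fun_ge_affine:
  assumes "\<And>y. 0 \<le> y \<Longrightarrow> ereal (l * y - P) \<le> f y"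
  shows "ereal (l * x - P) \<le> convex_hull_fun f x"
proof -
  have "convex {p :: real \<times> real. l * fst p - snd p \<le> P}"
    using convex_halfspace_le[of "(l, - 1) :: real \<times> real" P] by (simp add: inner_prod_def)
  moreover have "epi_nonneg f \<subseteq> {p. l * fst p - snd p \<le> P}"
  proof
    fix p assume "p \<in> epi_nonneg f"
    then have "0 \<le> fst p" "f (fst p) \<le> ereal (snd p)" by (auto simp: epi_nonneg_def)
    then have "ereal (l * fst p - P) \<le> ereal (snd p)" using assms order_trans by blast
    then show "p \<in> {p. l * fst p - snd p \<le> P}" by simp
  qed
  ultimately have "convex hull (epi_nonneg f) \<subseteq> {p. l * fst p - snd p \<le> P}"
    by (rule hull_minimal[rotated])
  then show ?thesis
    unfolding convex_hull_fun_def by (intro Inf_greatest) fastforce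
qed

lemma convex_hull_fun_le:
  assumes "0 \<le> x" "f x \<le> ereal \<alpha>" "0 \<le> y" "f y \<le> ereal \<beta>" "0 \<le> s" "0 \<le> t" "s + t = 1"
  shows "convex_hull_fun f (s * x + t * y) \<le> ereal (s * \<alpha> + t * \<beta>)"
proof -
  have "(x, \<alpha>) \<in> convex hull (epi_nonneg f)" "(y, \<beta>) \<in> convex hull (epi_nonneg f)"
    using assms by (auto simp: epi_nonneg_def intro!: hull_inc)
  then have "s *\<^sub>R (x, \<alpha>) + t *\<^sub>R (y, \<beta>) \<in> convex hull (epi_nonneg f)"
    using assms by (intro convexD convex_convex_hull)
  then show ?thesis
    unfolding convex_hull_fun_def by (intro Inf_lower) auto
qed

lemma cost_fun_le:
  assumes "(g, z) \<in> feasible_set m M"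
  shows "cost_fun C S m M (\<Sum>j\<in>UNIV. g j) \<le> ereal (total_cost C S g z)"
  unfolding cost_fun_def using assms by (intro Inf_lower) auto

text \<open>A dispatch with output \<open>y\<close> costs \<open>l * y\<close> minus its profit. If
  there is none, the cost is infinite.\<close>

lemma cost_fun_ge_affine:
  assumes "\<And>x. x \<in> feasible_set m M \<Longrightarrow> generator_profit C S l x \<le> P"
  shows "ereal (l * y - P) \<le> cost_fun C S m M y"
  unfolding cost_fun_def
  by (rule Inf_greatest) (use assms in \<open>fastforce simp: generator_profit_def\<close>)

section \<open>Concave maximization on a half-line\<close>

text \<open>For \<open>y\<close> beyond \<open>b\<close>, the point \<open>b\<close> lies strictly
  between \<open>x\<close> and \<open>y\<close>. A larger value at \<open>y\<close> would by
  concavity lift \<open>f b\<close> above \<open>f x\<close>.\<close>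

lemma concave_on_max_extend:
  fixes f :: "real \<Rightarrow> real"
  assumes f: "concave_on {0..} f" and x: "0 \<le> x" "x < b"
    and max: "\<And>y. y \<in> {0..b} \<Longrightarrow> f y \<le> f x" and y: "0 \<le> y"
  shows "f y \<le> f x"
proof (cases "y \<le> b")
  case True
  then show ?thesis using max y by simp
next
  case False
  define t where "t = (b - x) / (y - x)"
  have t: "0 < t" "t \<le> 1" using False x by (auto simp: t_def field_simps)
  have b: "(1 - t) *\<^sub>R x + t *\<^sub>R y = b"
  proof -
    have "t * (y - x) = b - x" using False x by (simp add: t_def)
    then show ?thesis by (simp add: algebra_simps)
  qed
  have "(1 - t) * f x + t * f y \<le> f b"
    using concave_onD[OF f, of t x y] t x y b by simp
  also have "f b \<le> f x" using max x by simp
  finally have "t * (f y - f x) \<le> 0" by (simp add: algebra_simps)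
  then show ?thesis using t by (simp add: mult_le_0_iff)
qed

section \<open>Duality\<close>

theorem proposition2:
  fixes u :: "real \<Rightarrow> real"
    and C :: "'j::finite \<Rightarrow> real \<Rightarrow> real"
    and S m M :: "'j \<Rightarrow> real"
  assumes u_nonneg: "\<And>d. 0 \<le> d \<Longrightarrow> 0 \<le> u d"
    and u_concave: "concave_on {0..} u"
    and u_mono: "mono_on {0..} u"
    and u_cont: "continuous_on {0..} u"
    and u_diff: "\<And>d. 0 < d \<Longrightarrow> u differentiable (at d)"
    and u_deriv: "(deriv u \<longlongrightarrow> 0) at_top"
    and C_nonneg: "\<And>j x. 0 \<le> x \<Longrightarrow> 0 \<le> C j x"
    and C_lsc: "\<And>j. lower_semicontinuous_on {0..} (C j)"
    and S_nonneg: "\<And>j. 0 \<le> S j"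
    and m_nonneg: "\<And>j. 0 \<le> m j"
    and m_le_M: "\<And>j. m j \<le> M j"
    and M_pos: "\<And>j. 0 < M j"
  shows "\<exists>(l::real) (g::'j \<Rightarrow> real) (z::'j \<Rightarrow> real) (d::real).
      (is_arg_min (dual_fun u C S m M) (\<lambda>_. True) l \<and>
       is_arg_max (\<lambda>d'. u d' - l * d') (\<lambda>d'. 0 \<le> d') d \<and>
       is_arg_max (generator_profit C S l) (\<lambda>x. x \<in> feasible_set m M) (g, z)) \<and>
      (\<exists>d0. is_arg_max (\<lambda>d'. ereal (u d') - convex_hull_fun (cost_fun C S m M) d')
              (\<lambda>d'. 0 \<le> d') d0 \<and>
            (INF l'. dual_fun u C S m M l') =
              ereal (u d0) - convex_hull_fun (cost_fun C S m M) d0) \<and>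
      l \<in> subdifferential_nonneg (convex_hull_fun (cost_fun C S m M)) d"
proof -
  define F where "F = feasible_set m M"
  define D where "D = (\<Sum>j\<in>UNIV. M j)"
  define total_g :: "('j \<Rightarrow> real) \<times> ('j \<Rightarrow> real) \<Rightarrow> real" where "total_g x = (\<Sum>j\<in>UNIV. fst x j)" for x
  define cost where "cost x = total_cost C S (fst x) (snd x)" for x
  have profit: "generator_profit C S l x = l * total_g x - cost x" for l x
    by (simp add: generator_profit_def total_g_def cost_def split: prod.split)
  have M_nonneg: "0 \<le> M j" for j using M_pos[of j] by simp
  have D: "D > 0" unfolding D_def by (rule sum_pos) (auto simp: M_pos)
  have total_g_bounds: "0 \<le> total_g x" "total_g x \<le> D" if "x \<in> F" for x
    using feasible_output_bounds[of "fst x" "snd x" m M] that m_nonneg M_nonneg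
    by (auto simp: total_g_def D_def F_def intro!: sum_nonneg sum_mono)
  \<comment> \<open>The margin 1 above the total capacity \<open>D\<close> serves twice: it allows a
    negative excess supply, and it keeps the mixed demand \<open>d \<le> D\<close> strictly below
    the bound, as \<open>concave_on_max_extend\<close> requires.\<close>
  define Q where "Q = F \<times> {0..D + 1}"
  define a where "a q = total_g (fst q) - snd q" for q :: "(('j \<Rightarrow> real) \<times> ('j \<Rightarrow> real)) \<times> real"
  define c where "c q = cost (fst q) + - u (snd q)" for q
  have "compact Q"
    unfolding Q_def F_def by (intro compact_Times compact_feasible_set compact_Icc m_nonneg M_nonneg)
  moreover have "continuous_on Q a"
    unfolding a_def total_g_def
    by (intro continuous_intros continuous_on_product_then_coordinatewise)
  moreover have "lower_semicontinuous_on Q c"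
    unfolding c_def
  proof (rule lower_semicontinuous_on_add)
    have "lower_semicontinuous_on F cost"
      unfolding F_def cost_def
      by (intro lower_semicontinuous_on_total_cost C_lsc m_nonneg M_nonneg)
    then show "lower_semicontinuous_on Q (\<lambda>q. cost (fst q))"
      by (rule lower_semicontinuous_on_compose) (auto simp: Q_def intro: continuous_intros)
    have "continuous_on Q (\<lambda>q. u (snd q))"
      by (rule continuous_on_compose2[OF u_cont]) (auto simp: Q_def intro: continuous_intros)
    then show "lower_semicontinuous_on Q (\<lambda>q. - u (snd q))"
      by (intro continuous_imp_lower_semicontinuous_on continuous_intros)
  qed
  \<comment> \<open>Full output without demand and, next, no output with demand \<open>D + 1\<close>
    give both signs of \<open>a\<close>.\<close>
  moreover have "((M, \<lambda>_. 1), 0) \<in> Q" "0 < a ((M, \<lambda>_. 1), 0)"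
    using D m_le_M by (auto simp: Q_def F_def feasible_set_def a_def total_g_def D_def)
  moreover have "((\<lambda>_. 0, \<lambda>_. 0), D + 1) \<in> Q" "a ((\<lambda>_. 0, \<lambda>_. 0), D + 1) < 0"
    using D by (auto simp: Q_def F_def feasible_set_def a_def total_g_def)
  ultimately obtain l p q where "p \<in> Q" "q \<in> Q" and ap: "a p \<le> 0" and aq: "0 \<le> a q"
    and max_p: "\<And>x. x \<in> Q \<Longrightarrow> l * a x - c x \<le> l * a p - c p"
    and max_q: "\<And>x. x \<in> Q \<Longrightarrow> l * a x - c x \<le> l * a q - c q"
    by (rule minimax_affine) blast
  obtain x d1 where p: "p = (x, d1)" and x: "x \<in> F" and d1: "0 \<le> d1" "d1 \<le> D + 1"
    using \<open>p \<in> Q\<close> by (auto simp: Q_def)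
  obtain y d2 where q: "q = (y, d2)" and y: "y \<in> F" and d2: "0 \<le> d2" "d2 \<le> D + 1"
    using \<open>q \<in> Q\<close> by (auto simp: Q_def)
  define W where "W d = u d - l * d" for d
  define \<pi> where "\<pi> x = l * total_g x - cost x" for x
  \<comment> \<open>The objective separates, so a joint maximizer maximizes profit and consumer
    surplus separately.\<close>
  have split: "l * a (x, d) - c (x, d) = \<pi> x + W d" for x d
    by (simp add: a_def c_def \<pi>_def W_def algebra_simps)
  have \<pi>x: "\<pi> x' \<le> \<pi> x" and \<pi>y: "\<pi> x' \<le> \<pi> y" if "x' \<in> F" for x'
    using max_p[of "(x', d1)"] max_q[of "(x', d2)"] that d1 d2
    unfolding p q split by (auto simp: Q_def)
  have W1: "W d' \<le> W d1" and W2: "W d' \<le> W d2" if "d' \<in> {0..D + 1}" for d'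
    using max_p[of "(x, d')"] max_q[of "(y, d')"] that x y
    unfolding p q split by (auto simp: Q_def)
  have \<pi>_eq: "\<pi> y = \<pi> x" using \<pi>x[OF y] \<pi>y[OF x] by simp
  have W_eq: "W d2 = W d1" using W1[of d2] W2[of d1] d1 d2 by simp
  \<comment> \<open>Weights that cancel the excess supply. If the two slopes agree, both are
    0.\<close>
  obtain s t where st: "0 \<le> s" "0 \<le> t" "s + t = 1" and "s * a p + t * a q = 0"
  proof (cases "a p = a q")
    case True
    then show ?thesis using that[of 1 0] ap aq by simp
  next
    case False
    then have pos: "0 < a q - a p" using ap aq by simp
    show ?thesis
    proof (rule that[of "a q / (a q - a p)" "- a p / (a q - a p)"])
      show "a q / (a q - a p) + - a p / (a q - a p) = 1"
        using pos by (simp flip: diff_divide_distrib)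
    qed (use pos ap aq in \<open>auto simp: divide_simps\<close>)
  qed
  define d where "d = s * d1 + t * d2"
  \<comment> \<open>Mixed demand equals mixed output. No single dispatch has to produce
    \<open>d\<close>, which is why the convex hull of the cost function enters.\<close>
  have d_total_g: "d = s * total_g x + t * total_g y"
    using \<open>s * a p + t * a q = 0\<close> by (simp add: d_def p q a_def algebra_simps)
  have d_nonneg: "0 \<le> d" using st d1 d2 by (simp add: d_def)
  have "d \<le> D"
    unfolding d_total_g using total_g_bounds x y st by (intro convex_bound_le)
  have mix: "s * k + t * k = k" for k :: real
    using st(3) by (metis distrib_right mult_1)
  have "concave_on {0..} W"
  proof -
    have "concave_on {0..} (\<lambda>d. - (l * d))"
      by (auto simp: concave_on_iff algebra_simps)
    from concave_on_add[OF u_concave this] show ?thesis by (simp add: W_def[abs_def])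
  qed
  moreover have "W d' \<le> W d" if "d' \<in> {0..D + 1}" for d'
  proof -
    have "s * W d1 + t * W d2 \<le> W d"
      using \<open>concave_on {0..} W\<close> st d1 d2 by (auto simp: concave_on_iff d_def)
    then show ?thesis using W1[OF that] mix[of "W d1"] W_eq by simp
  qed
  ultimately have W_max: "W d' \<le> W d" if "0 \<le> d'" for d'
    using concave_on_max_extend[of W d "D + 1" d'] d_nonneg \<open>d \<le> D\<close> that by simp
  define h where "h = convex_hull_fun (cost_fun C S m M)"
  \<comment> \<open>The height at \<open>d\<close> of the supporting line of slope \<open>l\<close>;
    it turns out to be both \<open>h d\<close> and the mixed cost of \<open>x\<close> and
    \<open>y\<close>.\<close>
  define V where "V = l * d - \<pi> x"
  have h_ge: "ereal (l * d' - \<pi> x) \<le> h d'" for d'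
    unfolding h_def using \<pi>x
    by (intro convex_hull_fun_ge_affine cost_fun_ge_affine) (simp add: profit F_def \<pi>_def)
  have V: "V = s * cost x + t * cost y"
  proof -
    have "V = l * d - (s * \<pi> x + t * \<pi> y)" by (simp add: V_def \<pi>_eq mix)
    then show ?thesis by (simp add: \<pi>_def d_total_g algebra_simps)
  qed
  have cost_le: "cost_fun C S m M (total_g x') \<le> ereal (cost x')" if "x' \<in> F" for x'
    using cost_fun_le[of "fst x'" "snd x'" m M C S] that by (simp add: F_def total_g_def cost_def)
  have h_d: "h d = ereal V"
  proof (rule antisym)
    show "h d \<le> ereal V"
      unfolding h_def V d_total_g using x y st total_g_bounds cost_le by (intro convex_hull_fun_le)
    show "ereal V \<le> h d" using h_ge[of d] by (simp add: V_def)
  qed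
  \<comment> \<open>Weak duality: at price \<open>l'\<close> the mixed profit of \<open>x\<close>
    and \<open>y\<close> is \<open>l' * d - V\<close>, so one of the two earns at least that
    much.\<close>
  have dual_ge: "ereal (u d - V) \<le> dual_fun u C S m M l'" for l'
  proof -
    obtain x' where x': "x' \<in> F" "l' * d - V \<le> l' * total_g x' - cost x'"
    proof -
      have "l' * d - V = s * (l' * total_g x - cost x) + t * (l' * total_g y - cost y)"
        by (simp add: V d_total_g algebra_simps)
      also have "\<dots> \<le> max (l' * total_g x - cost x) (l' * total_g y - cost y)"
        using st by (intro convex_bound_le) auto
      finally show ?thesis using that x y by (metis le_max_iff_disj)
    qed
    have "ereal (u d - V) \<le> ereal (u d - l' * d) + ereal (generator_profit C S l' x')"
      using x'(2) by (simp add: profit)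
    also have "\<dots> \<le> dual_fun u C S m M l'"
      unfolding dual_fun_def using d_nonneg x'(1)
      by (intro add_mono SUP_upper) (auto simp: F_def)
    finally show ?thesis .
  qed
  have dual_l: "dual_fun u C S m M l = ereal (u d - V)"
  proof (rule antisym[OF _ dual_ge])
    have "dual_fun u C S m M l \<le> ereal (W d) + ereal (\<pi> x)"
      unfolding dual_fun_def using W_max \<pi>x
      by (intro add_mono SUP_least) (auto simp: W_def profit F_def \<pi>_def)
    then show "dual_fun u C S m M l \<le> ereal (u d - V)" by (simp add: W_def V_def algebra_simps)
  qed
  have "is_arg_min (dual_fun u C S m M) (\<lambda>_. True) l"
    using dual_ge by (simp add: is_arg_min_linorder dual_l)
  moreover have "is_arg_max (\<lambda>d'. u d' - l * d') (\<lambda>d'. 0 \<le> d') d"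
    using W_max d_nonneg by (simp add: is_arg_max_linorder W_def)
  moreover have "is_arg_max (generator_profit C S l) (\<lambda>x. x \<in> feasible_set m M) (fst x, snd x)"
    using \<pi>x x by (simp add: is_arg_max_linorder profit \<pi>_def F_def)
  moreover have "is_arg_max (\<lambda>d'. ereal (u d') - h d') (\<lambda>d'. 0 \<le> d') d"
  proof -
    \<comment> \<open>Replacing \<open>h\<close> by its supporting line leaves
      \<open>W d' + \<pi> x\<close>, which is largest at \<open>d\<close>, where line and hull
      agree.\<close>
    have "ereal (u d') - h d' \<le> ereal (u d) - h d" if "0 \<le> d'" for d'
    proof -
      have "ereal (u d') - h d' \<le> ereal (u d') - ereal (l * d' - \<pi> x)"
        by (intro ereal_minus_mono h_ge order_refl)
      also have "\<dots> \<le> ereal (u d) - h d"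
        using W_max[OF that] by (simp add: h_d V_def W_def)
      finally show ?thesis .
    qed
    then show ?thesis using d_nonneg by (simp add: is_arg_max_linorder)
  qed
  moreover have "(INF l'. dual_fun u C S m M l') = ereal (u d) - h d"
  proof (rule antisym)
    show "(INF l'. dual_fun u C S m M l') \<le> ereal (u d) - h d"
      by (rule INF_lower2[of l]) (simp_all add: dual_l h_d)
    show "ereal (u d) - h d \<le> (INF l'. dual_fun u C S m M l')"
      by (rule INF_greatest) (simp add: dual_ge h_d)
  qed
  moreover have "l \<in> subdifferential_nonneg h d"
  proof -
    have "h d + ereal (l * (d' - d)) \<le> h d'" for d'
      using h_ge[of d'] by (simp add: h_d V_def algebra_simps)
    then show ?thesis using d_nonneg by (simp add: subdifferential_nonneg_def h_d)
  qed
  ultimately show ?thesis unfolding h_def by blast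
qed

end
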